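(* Let $H$ be a two-dimensional complex Hilbert space and let $a,b \in \mathcal{B}(H)$. Let $T_{a,b}\colon \mathcal{B}(H)\to\mathcal{B}(H)$ be given by $T_{a,b}(x) = axb + bxa$. Then $$\left\|T_{a,b}\right\|_{cb} \geq \|a\|_2\,\|b\|_2.$$
   Context: $\mathcal{B}(H)$ denotes the algebra of bounded linear operators on $H$. $\|x\|_2$ is the Hilbert-Schmidt norm, $\|x\|_2^2 = \operatorname{trace}(x^*x)$. $\|T\|_{cb} = \sup_n \|T^{(n)}\|$ is the completely bounded norm, where $T^{(n)}$ applies $T$ entrywise to $n\times n$ matrices over $\mathcal{B}(H)$, with $M_n(\mathcal{B}(H))$ normed as $\mathcal{B}(H^n)$. *)

theory Defs
  imports "HOL-Analysis.Analysis"
begin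

text \<open>
  Complex Hilbert spaces. The underlying real Banach space structure is inherited from
  class \<^class>\<open>banach\<close>, and its norm is required to be the one given by the inner product,
  which is conjugate-linear in its first argument and linear in its second.
\<close>

class complex_hilbert = banach +
  fixes scaleC :: "complex \<Rightarrow> 'a \<Rightarrow> 'a" (infixr "*\<^sub>C" 75)
    and cinner :: "'a \<Rightarrow> 'a \<Rightarrow> complex"
  assumes scaleC_add_right: "c *\<^sub>C (x + y) = c *\<^sub>C x + c *\<^sub>C y"
    and scaleC_add_left: "(c + d) *\<^sub>C x = c *\<^sub>C x + d *\<^sub>C x"
    and scaleC_scaleC: "c *\<^sub>C (d *\<^sub>C x) = (c * d) *\<^sub>C x"
    and scaleC_one: "1 *\<^sub>C x = x"
    and scaleR_scaleC: "r *\<^sub>R x = complex_of_real r *\<^sub>C x"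
    and cinner_commute: "cinner x y = cnj (cinner y x)"
    and cinner_add_right: "cinner x (y + z) = cinner x y + cinner x z"
    and cinner_scaleC_right: "cinner x (c *\<^sub>C y) = c * cinner x y"
    and norm_eq_sqrt_cinner: "norm x = sqrt (Re (cinner x x))"

global_interpretation complex_vector: vector_space "scaleC :: complex \<Rightarrow> 'a \<Rightarrow> 'a::complex_hilbert"
  by standard (rule scaleC_add_right scaleC_add_left scaleC_scaleC scaleC_one)+

text \<open>The space \<open>complex ^ 'n\<close> with its usual norm is an instance.\<close>

instantiation complex :: complex_hilbert
begin
definition scaleC_complex :: "complex \<Rightarrow> complex \<Rightarrow> complex" where
  "scaleC_complex c x = c * x"
definition cinner_complex :: "complex \<Rightarrow> complex \<Rightarrow> complex" where
  "cinner_complex x y = cnj x * y"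
instance
  by standard
    (auto simp: scaleC_complex_def cinner_complex_def algebra_simps scaleR_conv_of_real
       norm_complex_def power2_eq_square)
end

instantiation vec :: (complex_hilbert, finite) complex_hilbert
begin
definition scaleC_vec :: "complex \<Rightarrow> 'a ^ 'b \<Rightarrow> 'a ^ 'b" where
  "scaleC_vec c x = (\<chi> i. c *\<^sub>C x $ i)"
definition cinner_vec :: "'a ^ 'b \<Rightarrow> 'a ^ 'b \<Rightarrow> complex" where
  "cinner_vec x y = (\<Sum>i\<in>UNIV. cinner (x $ i) (y $ i))"
instance
proof
  fix x y z :: "'a ^ 'b" and c d :: complex and r :: real
  show "c *\<^sub>C (x + y) = c *\<^sub>C x + c *\<^sub>C y" "(c + d) *\<^sub>C x = c *\<^sub>C x + d *\<^sub>C x"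
    "c *\<^sub>C (d *\<^sub>C x) = (c * d) *\<^sub>C x" "1 *\<^sub>C x = x" "r *\<^sub>R x = complex_of_real r *\<^sub>C x"
    by (simp_all add: vec_eq_iff scaleC_vec_def scaleC_add_right scaleC_add_left scaleC_scaleC
        scaleC_one scaleR_scaleC)
  show "cinner x y = cnj (cinner y x)"
    unfolding cinner_vec_def cnj_sum by (intro sum.cong refl cinner_commute)
  show "cinner x (y + z) = cinner x y + cinner x z" "cinner x (c *\<^sub>C y) = c * cinner x y"
    by (simp_all add: cinner_vec_def scaleC_vec_def cinner_add_right cinner_scaleC_right
        sum.distrib sum_distrib_left)
  have "0 \<le> Re (cinner u u)" for u :: 'a
    using norm_eq_sqrt_cinner[of u] norm_ge_zero[of u] by simp
  then show "norm x = sqrt (Re (cinner x x))"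
    by (simp add: norm_vec_def L2_set_def cinner_vec_def norm_eq_sqrt_cinner)
qed
end

definition bounded_clinear :: "('a::complex_hilbert \<Rightarrow> 'a) \<Rightarrow> bool" where
  "bounded_clinear f \<longleftrightarrow> bounded_linear f \<and> (\<forall>c x. f (c *\<^sub>C x) = c *\<^sub>C f x)"

definition cadjoint :: "('a::complex_hilbert \<Rightarrow> 'a) \<Rightarrow> 'a \<Rightarrow> 'a" where
  "cadjoint f = (THE g. \<forall>x y. cinner (f x) y = cinner x (g y))"

definition orthonormal_basis :: "'a::complex_hilbert set \<Rightarrow> bool" where
  "orthonormal_basis B \<longleftrightarrow>
     (\<forall>e\<in>B. \<forall>e'\<in>B. cinner e e' = (if e = e' then 1 else 0)) \<and> complex_vector.span B = UNIV"

text \<open>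
  The trace is meant for finite-dimensional spaces only, where orthonormal bases in the above
  algebraic sense exist, are finite, and all give the same value.
\<close>

definition ctrace :: "('a::complex_hilbert \<Rightarrow> 'a) \<Rightarrow> complex" where
  "ctrace f = (\<Sum>e\<in>(SOME B. orthonormal_basis B). cinner e (f e))"

definition hs_norm :: "('a::complex_hilbert \<Rightarrow> 'a) \<Rightarrow> real" where
  "hs_norm x = sqrt (Re (ctrace (cadjoint x \<circ> x)))"

text \<open>
  Elements of \<open>H\<^sup>n\<close> are functions \<open>v :: nat \<Rightarrow> 'a\<close> and elements of \<open>M\<^sub>n(\<B>(H))\<close> are functions
  \<open>X :: nat \<Rightarrow> nat \<Rightarrow> 'a \<Rightarrow> 'a\<close>; only indices below \<open>n\<close> matter. Suprema are taken in the
  extended reals, so that an unbounded map has norm \<open>\<infinity>\<close>.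
\<close>

definition tuple_norm :: "nat \<Rightarrow> (nat \<Rightarrow> 'a::complex_hilbert) \<Rightarrow> real" where
  "tuple_norm n v = sqrt (\<Sum>i<n. (norm (v i))\<^sup>2)"

definition op_matrix :: "nat \<Rightarrow> (nat \<Rightarrow> nat \<Rightarrow> 'a::complex_hilbert \<Rightarrow> 'a) \<Rightarrow> bool" where
  "op_matrix n X \<longleftrightarrow> (\<forall>i<n. \<forall>j<n. bounded_clinear (X i j))"

definition op_matrix_apply ::
    "nat \<Rightarrow> (nat \<Rightarrow> nat \<Rightarrow> 'a::complex_hilbert \<Rightarrow> 'a) \<Rightarrow> (nat \<Rightarrow> 'a) \<Rightarrow> nat \<Rightarrow> 'a" where
  "op_matrix_apply n X v = (\<lambda>i. \<Sum>j<n. X i j (v j))"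

definition op_matrix_norm ::
    "nat \<Rightarrow> (nat \<Rightarrow> nat \<Rightarrow> 'a::complex_hilbert \<Rightarrow> 'a) \<Rightarrow> ereal" where
  "op_matrix_norm n X =
     (SUP v\<in>{v. tuple_norm n v \<le> 1}. ereal (tuple_norm n (op_matrix_apply n X v)))"

definition amplification ::
    "(('a \<Rightarrow> 'a) \<Rightarrow> ('a \<Rightarrow> 'a)) \<Rightarrow> (nat \<Rightarrow> nat \<Rightarrow> 'a \<Rightarrow> 'a) \<Rightarrow> nat \<Rightarrow> nat \<Rightarrow> 'a \<Rightarrow> 'a" where
  "amplification T X = (\<lambda>i j. T (X i j))"

definition amplification_norm ::
    "nat \<Rightarrow> (('a::complex_hilbert \<Rightarrow> 'a) \<Rightarrow> ('a \<Rightarrow> 'a)) \<Rightarrow> ereal" where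
  "amplification_norm n T =
     (SUP X\<in>{X. op_matrix n X \<and> op_matrix_norm n X \<le> 1}. op_matrix_norm n (amplification T X))"

definition cb_norm :: "(('a::complex_hilbert \<Rightarrow> 'a) \<Rightarrow> ('a \<Rightarrow> 'a)) \<Rightarrow> ereal" where
  "cb_norm T = (SUP n\<in>{1..}. amplification_norm n T)"

definition T_op ::
    "('a::complex_hilbert \<Rightarrow> 'a) \<Rightarrow> ('a \<Rightarrow> 'a) \<Rightarrow> ('a \<Rightarrow> 'a) \<Rightarrow> 'a \<Rightarrow> 'a" where
  "T_op a b x = (\<lambda>v. (a \<circ> x \<circ> b) v + (b \<circ> x \<circ> a) v)"

lemma bounded_clinear_T_op:
  assumes "bounded_clinear a" "bounded_clinear b" "bounded_clinear x"
  shows "bounded_clinear (T_op a b x)"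
  using assms unfolding bounded_clinear_def T_op_def
  by (auto simp: o_def scaleC_add_right
      intro!: bounded_linear_add bounded_linear_compose[of a] bounded_linear_compose[of b]
        bounded_linear_compose[of x])

end

theory Submission imports Defs begin

text \<open>
  Let \<open>e\<^sub>0, e\<^sub>1\<close> be an orthonormal basis of \<open>H\<close> and put \<open>A = (a e\<^sub>0, a e\<^sub>1)\<close>, \<open>A' = (a\<^sup>* e\<^sub>0, a\<^sup>* e\<^sub>1)\<close>
  in \<open>H\<^sup>2\<close>, and similarly \<open>B\<close>, \<open>B'\<close>. Then \<open>\<parallel>A\<parallel> = \<parallel>A'\<parallel>\<close> is the Hilbert-Schmidt norm of \<open>a\<close>, and
  \<open>\<langle>A, B\<rangle> = trace (a\<^sup>* b) = \<langle>B', A'\<rangle>\<close>. Hence the assignment \<open>A / \<parallel>A\<parallel> \<mapsto> B' / \<parallel>B\<parallel>\<close>,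
  \<open>B / \<parallel>B\<parallel> \<mapsto> A' / \<parallel>A\<parallel>\<close> preserves inner products and extends to a contraction \<open>X\<close> of \<open>H\<^sup>2\<close>.
  For the unit vector \<open>\<xi> = (e\<^sub>0, e\<^sub>1) / \<surd>2\<close> and the second amplification of \<open>T\<close>,
  \<open>\<langle>\<xi>, T(X) \<xi>\<rangle> = (\<langle>A', X B\<rangle> + \<langle>B', X A\<rangle>) / 2 = \<parallel>A\<parallel> \<parallel>B\<parallel>\<close>.
\<close>

section \<open>Complex inner products\<close>

lemma cinner_add_left: "cinner (x + y) z = cinner x z + cinner y z"
  by (metis cinner_add_right cinner_commute complex_cnj_add)

lemma cinner_scaleC_left: "cinner (c *\<^sub>C x) y = cnj c * cinner x y"
  by (metis cinner_commute cinner_scaleC_right complex_cnj_mult)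

lemma cinner_zero_right [simp]: "cinner x 0 = 0"
  using cinner_add_right[of x 0 0] by simp

lemma cinner_zero_left [simp]: "cinner 0 x = 0"
  using cinner_add_left[of 0 0 x] by simp

lemma cinner_minus_right: "cinner x (- y) = - cinner x y"
  using cinner_add_right[of x y "- y"] by (simp add: add_eq_0_iff)

lemma cinner_minus_left: "cinner (- x) y = - cinner x y"
  using cinner_add_left[of x "- x" y] by (simp add: add_eq_0_iff)

lemma cinner_diff_right: "cinner x (y - z) = cinner x y - cinner x z"
  using cinner_add_right[of x y "- z"] by (simp add: cinner_minus_right)

lemma cinner_diff_left: "cinner (x - y) z = cinner x z - cinner y z"
  using cinner_add_left[of x "- y" z] by (simp add: cinner_minus_left)

lemma cinner_sum_right: "cinner x (\<Sum>i\<in>I. f i) = (\<Sum>i\<in>I. cinner x (f i))"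
  by (induction I rule: infinite_finite_induct) (auto simp: cinner_add_right)

lemma cinner_sum_left: "cinner (\<Sum>i\<in>I. f i) x = (\<Sum>i\<in>I. cinner (f i) x)"
  by (induction I rule: infinite_finite_induct) (auto simp: cinner_add_left)

lemmas cinner_simps = cinner_add_left cinner_add_right cinner_diff_left cinner_diff_right
  cinner_scaleC_left cinner_scaleC_right

lemma cinner_self: "cinner x x = complex_of_real ((norm x)\<^sup>2)"
proof -
  have "Im (cinner x x) = 0"
    using cinner_commute[of x x] by (metis Reals_cnj_iff complex_is_Real_iff)
  moreover have "Re (cinner x x) \<ge> 0"
    using norm_eq_sqrt_cinner[of x] norm_ge_zero[of x] by simp
  ultimately show ?thesis
    by (simp add: complex_eq_iff norm_eq_sqrt_cinner)
qed

lemma power2_norm_eq_cinner: "(norm x)\<^sup>2 = Re (cinner x x)"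
  by (simp add: cinner_self)

lemma cinner_ext: "(\<And>x. cinner x y = cinner x z) \<Longrightarrow> y = z"
  using cinner_self[of "y - z"] by (simp add: cinner_diff_right)

text \<open>Removing from \<open>y\<close> its component along the unit vector \<open>x\<close>
  leaves a vector of nonnegative squared norm. Taking only the real part \<open>t\<close> as
  coefficient suffices for this one-sided Cauchy-Schwarz bound.\<close>

lemma Re_cinner_le_norm:
  assumes "norm x = 1"
  shows "Re (cinner x y) \<le> norm y"
proof -
  define t where "t = Re (cinner x y)"
  have t: "Re (cinner y x) = t"
    unfolding t_def by (subst cinner_commute) simp
  have "0 \<le> (norm (y - complex_of_real t *\<^sub>C x))\<^sup>2"
    by simp
  also have "\<dots> = (norm y)\<^sup>2 - t\<^sup>2"
    unfolding power2_norm_eq_cinner using t assms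
    by (simp add: cinner_simps cinner_self[of x] t_def[symmetric] power2_eq_square algebra_simps)
  finally show ?thesis
    unfolding t_def using norm_ge_zero power2_le_imp_le by fastforce
qed

lemma norm_scaleC: "norm (c *\<^sub>C x) = cmod c * norm x"
proof (rule power2_eq_imp_eq)
  have "cinner (c *\<^sub>C x) (c *\<^sub>C x) = (c * cnj c) * cinner x x"
    by (simp add: cinner_simps)
  also have "\<dots> = complex_of_real ((cmod c * norm x)\<^sup>2)"
    by (simp add: cinner_self complex_norm_square[symmetric] power_mult_distrib)
  finally show "(norm (c *\<^sub>C x))\<^sup>2 = (cmod c * norm x)\<^sup>2"
    by (simp add: power2_norm_eq_cinner)
qed auto

lemma bounded_clinear_add: "bounded_clinear f \<Longrightarrow> f (x + y) = f x + f y"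
  by (simp add: bounded_clinear_def linear_simps)

lemma bounded_clinear_scaleC: "bounded_clinear f \<Longrightarrow> f (c *\<^sub>C x) = c *\<^sub>C f x"
  by (simp add: bounded_clinear_def)

lemma bounded_clinear_sum: "bounded_clinear f \<Longrightarrow> f (\<Sum>i\<in>I. g i) = (\<Sum>i\<in>I. f (g i))"
  by (simp add: bounded_clinear_def bounded_linear.linear linear_sum)

section \<open>Extending an isometric assignment to a contraction\<close>

lemma bessel_two:
  assumes "norm u = 1" "w = 0 \<or> norm w = 1" "cinner u w = 0"
  shows "(cmod (cinner u v))\<^sup>2 + (cmod (cinner w v))\<^sup>2 \<le> (norm v)\<^sup>2"
proof -
  define \<alpha> \<beta> where "\<alpha> = cinner u v" and "\<beta> = cinner w v"
  have *: "cinner v u = cnj \<alpha>" "cinner v w = cnj \<beta>" "cinner w u = 0"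
    unfolding \<alpha>_def \<beta>_def using assms(3) by (metis cinner_commute complex_cnj_zero)+
  have \<beta>: "\<beta> * cnj \<beta> * (norm w)\<^sup>2 = \<beta> * cnj \<beta>"
    using assms(2) by (auto simp: \<beta>_def)
  let ?r = "v - \<alpha> *\<^sub>C u - \<beta> *\<^sub>C w"
  have "cinner ?r ?r = (norm v)\<^sup>2 - \<alpha> * cnj \<alpha> - 2 * (\<beta> * cnj \<beta>) + \<beta> * cnj \<beta> * (norm w)\<^sup>2"
    using * assms
    by (simp add: cinner_simps cinner_self[of u] cinner_self[of v] cinner_self[of w]
        \<alpha>_def[symmetric] \<beta>_def[symmetric] algebra_simps)
  also have "\<dots> = complex_of_real ((norm v)\<^sup>2 - (cmod \<alpha>)\<^sup>2 - (cmod \<beta>)\<^sup>2)"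
    unfolding \<beta> by (simp add: complex_norm_square[symmetric])
  finally have "(norm ?r)\<^sup>2 = (norm v)\<^sup>2 - (cmod \<alpha>)\<^sup>2 - (cmod \<beta>)\<^sup>2"
    by (simp add: power2_norm_eq_cinner)
  then show ?thesis
    using zero_le_power2[of "norm ?r"] by (simp add: \<alpha>_def \<beta>_def)
qed

text \<open>Gram-Schmidt on \<open>(A, B)\<close> and on \<open>(B', A')\<close> uses the same
  coefficients \<open>z\<close> and \<open>s\<close>, since the inner products agree:
  \<open>B = z A + s u\<close> and \<open>A' = z B' + s w\<close>. The partial isometry taking
  \<open>A\<close> to \<open>B'\<close> and \<open>u\<close> to \<open>w\<close> therefore takes
  \<open>B\<close> to \<open>A'\<close>.\<close>

lemma contraction_extending_unit:
  fixes A B A' B' :: "'k::complex_hilbert"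
  assumes n: "norm A = 1" "norm B = 1" "norm A' = 1" "norm B' = 1"
    and AB: "cinner A B = cinner B' A'"
  obtains \<phi> :: "'k \<Rightarrow> 'k"
  where "bounded_clinear \<phi>" "\<And>v. norm (\<phi> v) \<le> norm v" "\<phi> A = B'" "\<phi> B = A'"
proof -
  define z where "z = cinner A B"
  define s where "s = sqrt (1 - (cmod z)\<^sup>2)"
  have z: "cinner A B = z" "cinner B' A' = z" "cinner B A = cnj z" "cinner A' B' = cnj z"
    using AB by (auto simp: z_def intro: cinner_commute) (metis cinner_commute)+
  have res: "(norm (y - z *\<^sub>C x))\<^sup>2 = 1 - (cmod z)\<^sup>2"
    if "norm x = 1" "norm y = 1" "cinner x y = z" for x y :: 'k
  proof -
    have "cinner y x = cnj z"
      using that(3) cinner_commute by metis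
    then have "cinner (y - z *\<^sub>C x) (y - z *\<^sub>C x) = 1 - z * cnj z"
      using that by (simp add: cinner_simps cinner_self[of x] cinner_self[of y])
    then show ?thesis
      by (simp add: power2_norm_eq_cinner complex_norm_square[symmetric] del: Re_complex_of_real)
        (simp add: complex_mult_cnj cmod_power2)
  qed
  have s: "norm (y - z *\<^sub>C x) = s"
    if "norm x = 1" "norm y = 1" "cinner x y = z" for x y :: 'k
    using res[OF that] unfolding s_def by (metis norm_ge_zero real_sqrt_unique)
  \<comment> \<open>If \<open>s = 0\<close>, i.e. if \<open>B\<close> is a multiple of \<open>A\<close>, then \<open>u = w = 0\<close>.\<close>
  define u where "u = complex_of_real (1 / s) *\<^sub>C (B - z *\<^sub>C A)"
  define w where "w = complex_of_real (1 / s) *\<^sub>C (A' - z *\<^sub>C B')"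
  have su: "norm (B - z *\<^sub>C A) = s" and sw: "norm (A' - z *\<^sub>C B') = s"
    using s n z by auto
  then have "s \<ge> 0"
    using norm_ge_zero by metis
  have u: "u = 0 \<or> norm u = 1" and w: "w = 0 \<or> norm w = 1"
    using su sw \<open>s \<ge> 0\<close> unfolding u_def w_def by (auto simp: norm_scaleC norm_divide)
  have Au: "cinner A u = 0" and Bw: "cinner B' w = 0"
    unfolding u_def w_def using z n by (auto simp: cinner_simps cinner_self[of A] cinner_self[of B'])
  have uA: "cinner u A = 0" and wB: "cinner w B' = 0"
    using Au Bw by (metis cinner_commute complex_cnj_zero)+
  have B_eq: "B = z *\<^sub>C A + complex_of_real s *\<^sub>C u" and A'_eq: "A' = z *\<^sub>C B' + complex_of_real s *\<^sub>C w"
    using su sw unfolding u_def w_def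
    by (cases "s = 0"; force simp: scaleC_scaleC scaleC_one)+
  \<comment> \<open>The factor \<open>s\<close> covers both cases: \<open>u\<close> is a unit vector
    if \<open>s\<close> is nonzero, and otherwise both sides vanish.\<close>
  have uu: "cinner u u * complex_of_real s = complex_of_real s"
    using u su by (cases "s = 0") (auto simp: u_def cinner_self)
  define \<phi> where "\<phi> v = cinner A v *\<^sub>C B' + cinner u v *\<^sub>C w" for v
  have contr: "norm (\<phi> v) \<le> norm v" for v
  proof (rule power2_le_imp_le)
    have "cinner (\<phi> v) (\<phi> v) = cinner A v * cnj (cinner A v) +
        cinner u v * cnj (cinner u v) * (norm w)\<^sup>2"
      unfolding \<phi>_def using n Bw wB
      by (simp add: cinner_simps cinner_self[of w] cinner_self[of B'] algebra_simps)
    also have "\<dots> = complex_of_real ((cmod (cinner A v))\<^sup>2 + (cmod (cinner u v))\<^sup>2 * (norm w)\<^sup>2)"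
      by (simp add: complex_norm_square[symmetric])
    finally have "(norm (\<phi> v))\<^sup>2 = (cmod (cinner A v))\<^sup>2 + (cmod (cinner u v))\<^sup>2 * (norm w)\<^sup>2"
      by (simp add: power2_norm_eq_cinner)
    also have "\<dots> \<le> (cmod (cinner A v))\<^sup>2 + (cmod (cinner u v))\<^sup>2"
      using w by auto
    also have "\<dots> \<le> (norm v)\<^sup>2"
      using bessel_two n u Au by blast
    finally show "(norm (\<phi> v))\<^sup>2 \<le> (norm v)\<^sup>2" .
  qed auto
  have scale: "\<phi> (c *\<^sub>C v) = c *\<^sub>C \<phi> v" for c v
    by (simp add: \<phi>_def cinner_simps scaleC_add_right scaleC_scaleC)
  have "bounded_linear \<phi>"
  proof (rule bounded_linear_intro[where K = 1])
    show "\<phi> (x + y) = \<phi> x + \<phi> y" for x y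
      by (simp add: \<phi>_def cinner_simps scaleC_add_left)
  qed (use contr scale in \<open>auto simp: scaleR_scaleC\<close>)
  then have lin: "bounded_clinear \<phi>"
    using scale by (simp add: bounded_clinear_def)
  have A: "\<phi> A = B'"
    unfolding \<phi>_def using n uA by (simp add: cinner_self[of A] scaleC_one)
  have u: "complex_of_real s *\<^sub>C \<phi> u = complex_of_real s *\<^sub>C w"
    unfolding \<phi>_def using Au uu by (simp add: scaleC_scaleC mult.commute)
  have "\<phi> B = z *\<^sub>C \<phi> A + complex_of_real s *\<^sub>C \<phi> u"
    by (subst B_eq) (simp add: bounded_clinear_add[OF lin] scale)
  then have "\<phi> B = A'"
    using A u A'_eq by simp
  with that lin contr A show ?thesis
    by blast
qed

text \<open>Normalising all four vectors reduces to unit vectors; undoing the normalisation produces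
  the quotients of norms.\<close>

lemma contraction_extending:
  fixes A B A' B' :: "'k::complex_hilbert"
  assumes n: "norm A' = norm A" "norm B' = norm B" and AB: "cinner A B = cinner B' A'"
  obtains \<phi> :: "'k \<Rightarrow> 'k"
  where "bounded_clinear \<phi>" "\<And>v. norm (\<phi> v) \<le> norm v"
    "\<phi> A = complex_of_real (norm A / norm B) *\<^sub>C B'" "\<phi> B = complex_of_real (norm B / norm A) *\<^sub>C A'"
proof (cases "A = 0 \<or> B = 0")
  case True
  \<comment> \<open>As \<open>x / 0 = 0\<close>, both quotients of norms are 0 here, so the zero map
    satisfies both equations.\<close>
  show ?thesis
    by (rule that[of "\<lambda>_. 0"]) (use True in \<open>auto simp: bounded_clinear_def\<close>)
next
  case False
  let ?c = "\<lambda>x::'k. complex_of_real (1 / norm x)"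
  have "norm (?c A *\<^sub>C A) = 1" "norm (?c B *\<^sub>C B) = 1" "norm (?c A *\<^sub>C A') = 1" "norm (?c B *\<^sub>C B') = 1"
    "cinner (?c A *\<^sub>C A) (?c B *\<^sub>C B) = cinner (?c B *\<^sub>C B') (?c A *\<^sub>C A')"
    using False n AB by (auto simp: norm_scaleC norm_divide cinner_simps)
  then obtain \<phi> :: "'k \<Rightarrow> 'k" where \<phi>: "bounded_clinear \<phi>" "\<And>v. norm (\<phi> v) \<le> norm v"
    "\<phi> (?c A *\<^sub>C A) = ?c B *\<^sub>C B'" "\<phi> (?c B *\<^sub>C B) = ?c A *\<^sub>C A'"
    using contraction_extending_unit by metis
  have unscale: "complex_of_real (norm x) *\<^sub>C \<phi> (?c x *\<^sub>C x) = \<phi> x" if "x \<noteq> 0" for x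
    using that by (simp add: bounded_clinear_scaleC[OF \<phi>(1)] scaleC_scaleC scaleC_one)
  show ?thesis
  proof (rule that[OF \<phi>(1,2)])
    show "\<phi> A = complex_of_real (norm A / norm B) *\<^sub>C B'"
      using unscale[of A] False unfolding \<phi>(3) by (simp add: scaleC_scaleC)
    show "\<phi> B = complex_of_real (norm B / norm A) *\<^sub>C A'"
      using unscale[of B] False unfolding \<phi>(4) by (simp add: scaleC_scaleC)
  qed
qed

section \<open>Orthonormal bases and adjoints\<close>

text \<open>Gram-Schmidt applied to a basis \<open>{p, q}\<close>. Existence is what gives meaning
  to the choice by \<open>SOME\<close> in \<open>ctrace\<close>.\<close>

lemma orthonormal_basis_exists_dim_2:
  assumes "complex_vector.dim (UNIV :: 'h::complex_hilbert set) = 2"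
  shows "\<exists>E :: 'h set. orthonormal_basis E"
proof -
  obtain S :: "'h set" where S: "complex_vector.independent S" "complex_vector.span S = UNIV"
    "card S = 2"
    using complex_vector.basis_exists[of UNIV] assms by (metis top.extremum_unique)
  then obtain p q where pq: "S = {p, q}" "p \<noteq> q"
    by (metis card_2_iff)
  have "p \<noteq> 0"
    using S(1) pq complex_vector.dependent_zero by blast
  define e where "e = complex_of_real (1 / norm p) *\<^sub>C p"
  define r where "r = q - cinner e q *\<^sub>C e"
  define f where "f = complex_of_real (1 / norm r) *\<^sub>C r"
  have e: "norm e = 1"
    using \<open>p \<noteq> 0\<close> by (simp add: e_def norm_scaleC norm_divide)
  have p_eq: "p = complex_of_real (norm p) *\<^sub>C e"
    using \<open>p \<noteq> 0\<close> by (simp add: e_def scaleC_scaleC scaleC_one)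
  have "r \<noteq> 0"
  proof
    assume "r = 0"
    then have "q = (cinner e q * complex_of_real (1 / norm p)) *\<^sub>C p"
      by (simp add: r_def e_def scaleC_scaleC)
    then have "q \<in> complex_vector.span {p}"
      by (metis complex_vector.span_base complex_vector.span_scale singletonI)
    moreover have "S - {q} = {p}"
      using pq by auto
    ultimately show False
      using S(1) pq(1) unfolding complex_vector.dependent_def by (metis insertCI)
  qed
  then have f: "norm f = 1" and q_eq: "q = cinner e q *\<^sub>C e + complex_of_real (norm r) *\<^sub>C f"
    by (simp_all add: f_def norm_scaleC norm_divide scaleC_scaleC scaleC_one r_def)
  have ef: "cinner e f = 0"
    using e by (simp add: f_def r_def cinner_simps cinner_self[of e])
  then have fe: "cinner f e = 0"
    by (metis cinner_commute complex_cnj_zero)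
  have "{e, f} \<subseteq> complex_vector.span {e, f}"
    by (rule complex_vector.span_superset)
  then have "p \<in> complex_vector.span {e, f}" "q \<in> complex_vector.span {e, f}"
    by (subst p_eq q_eq, intro complex_vector.span_add complex_vector.span_scale; simp)+
  then have "complex_vector.span S \<subseteq> complex_vector.span {e, f}"
    using pq by (intro complex_vector.span_minimal) auto
  then have "complex_vector.span {e, f} = UNIV"
    using S by auto
  then have "orthonormal_basis {e, f}"
    using e f ef fe by (auto simp: orthonormal_basis_def cinner_self)
  then show ?thesis
    by blast
qed

text \<open>Pairing a vanishing linear combination with one of its vectors isolates the coefficient
  of that vector.\<close>

lemma orthonormal_basis_independent:
  assumes "orthonormal_basis E"
  shows "complex_vector.independent E"
  unfolding complex_vector.independent_explicit_module
proof safe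
  fix t u v
  assume t: "finite t" "t \<subseteq> E" "(\<Sum>v\<in>t. u v *\<^sub>C v) = 0" "v \<in> t"
  have "0 = cinner v (\<Sum>v\<in>t. u v *\<^sub>C v)"
    using t by simp
  also have "\<dots> = (\<Sum>w\<in>t. if v = w then u w else 0)"
    unfolding cinner_sum_right
    by (rule sum.cong) (use t assms in \<open>auto simp: cinner_simps orthonormal_basis_def subset_iff\<close>)
  also have "\<dots> = u v"
    using t by simp
  finally show "u v = 0"
    by simp
qed

lemma orthonormal_basis_card:
  fixes E :: "'h::complex_hilbert set"
  shows "orthonormal_basis E \<Longrightarrow> card E = complex_vector.dim (UNIV :: 'h set)"
  using complex_vector.dim_eq_card orthonormal_basis_independent
  unfolding orthonormal_basis_def by (metis complex_vector.span_UNIV)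

locale finite_onb =
  fixes E :: "'h::complex_hilbert set"
  assumes onb: "orthonormal_basis E" and fin: "finite E"
begin

lemma expansion: "x = (\<Sum>e\<in>E. cinner e x *\<^sub>C e)"
proof -
  let ?P = "\<lambda>x. (\<Sum>e\<in>E. cinner e x *\<^sub>C e)"
  have "x \<in> complex_vector.span E"
    using onb by (simp add: orthonormal_basis_def)
  then show ?thesis
  proof (induction rule: complex_vector.span_induct_alt)
    case (step c e y)
    have "(\<Sum>f\<in>E. (c * cinner f e) *\<^sub>C f) = (\<Sum>f\<in>E. if e = f then c *\<^sub>C f else 0)"
      by (rule sum.cong) (use onb step(1) in \<open>auto simp: orthonormal_basis_def\<close>)
    then have "(\<Sum>f\<in>E. (c * cinner f e) *\<^sub>C f) = c *\<^sub>C e"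
      using step(1) fin by simp
    then show ?case
      using step by (simp add: cinner_simps scaleC_add_left sum.distrib)
  qed simp
qed

lemma parseval: "cinner x y = (\<Sum>e\<in>E. cinner x e * cinner e y)"
  by (subst expansion[of y]) (simp add: cinner_sum_right cinner_simps mult.commute)

text \<open>The description by \<open>THE\<close> in \<open>cadjoint\<close> needs existence and
  uniqueness. The basis expansion supplies the explicit adjoint \<open>g\<close>; nondegeneracy of
  the inner product makes it unique.\<close>

lemma cinner_cadjoint:
  fixes f :: "'h \<Rightarrow> 'h"
  assumes f: "bounded_clinear f"
  shows "cinner (f x) y = cinner x (cadjoint f y)"
proof -
  define g where "g y = (\<Sum>e\<in>E. cinner (f e) y *\<^sub>C e)" for y
  have g: "cinner (f x) y = cinner x (g y)" for x y
  proof -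
    have "f x = (\<Sum>e\<in>E. cinner e x *\<^sub>C f e)"
      by (subst expansion[of x]) (simp add: bounded_clinear_sum[OF f] bounded_clinear_scaleC[OF f])
    then have "cinner (f x) y = (\<Sum>e\<in>E. cnj (cinner e x) * cinner (f e) y)"
      by (simp add: cinner_sum_left cinner_simps)
    then show ?thesis
      by (simp add: g_def cinner_sum_right cinner_simps mult.commute flip: cinner_commute[of x])
  qed
  have "\<exists>!g. \<forall>x y. cinner (f x) y = cinner x (g y)"
  proof (rule ex1I[of _ g])
    fix h assume "\<forall>x y. cinner (f x) y = cinner x (h y)"
    then show "h = g"
      using g by (metis cinner_ext ext)
  qed (use g in blast)
  from theI'[OF this] show ?thesis
    unfolding cadjoint_def by blast
qed

lemma cinner_cadjoint':
  "bounded_clinear f \<Longrightarrow> cinner (cadjoint f x) (y :: 'h) = cinner x (f y)"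
  by (subst (1 2) cinner_commute) (simp add: cinner_cadjoint[of f])

lemma sum_cinner_cadjoint:
  assumes "bounded_clinear f" "bounded_clinear g"
  shows "(\<Sum>e\<in>E. cinner (f e) (g e)) = (\<Sum>e\<in>E. cinner (cadjoint g e) (cadjoint f e))"
proof -
  have "(\<Sum>e\<in>E. cinner (f e) (g e)) = (\<Sum>e\<in>E. \<Sum>d\<in>E. cinner (f e) d * cinner d (g e))"
    by (intro sum.cong refl parseval)
  also have "\<dots> = (\<Sum>d\<in>E. \<Sum>e\<in>E. cinner (cadjoint g d) e * cinner e (cadjoint f d))"
    by (subst sum.swap) (simp add: cinner_cadjoint[OF assms(1)] cinner_cadjoint'[OF assms(2)] mult.commute)
  also have "\<dots> = (\<Sum>d\<in>E. cinner (cadjoint g d) (cadjoint f d))"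
    by (simp add: parseval[symmetric])
  finally show ?thesis .
qed

end

section \<open>Pairs of vectors and two by two operator matrices\<close>

text \<open>Carries a tuple indexed by \<open>nat\<close>, as in \<open>tuple_norm\<close>, to the
  type \<open>'h ^ bool\<close>, which is itself a complex Hilbert space, so that the extension
  lemma applies to it. \<open>False\<close> stands for 0 and \<open>True\<close> for 1.\<close>

definition vec_pair :: "(nat \<Rightarrow> 'h) \<Rightarrow> 'h ^ bool" where
  "vec_pair v = (\<chi> i. v (of_bool i))"

lemma cinner_vec_pair: "cinner (vec_pair v) (vec_pair w) = (\<Sum>i<2. cinner (v i) (w i))"
  by (simp add: cinner_vec_def vec_pair_def UNIV_bool numeral_2_eq_2)

lemma tuple_norm_2: "tuple_norm 2 v = norm (vec_pair v)"
  by (simp add: tuple_norm_def norm_vec_def L2_set_def vec_pair_def UNIV_bool numeral_2_eq_2)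

text \<open>The block matrix of \<open>\<phi>\<close>: embed into coordinate \<open>j\<close>, apply
  \<open>\<phi>\<close>, project to coordinate \<open>i\<close>. The test \<open>i = 1\<close>
  inverts \<open>of_bool\<close> on the indices below 2.\<close>

definition op_matrix_of :: "('h::complex_hilbert ^ bool \<Rightarrow> 'h ^ bool) \<Rightarrow> nat \<Rightarrow> nat \<Rightarrow> 'h \<Rightarrow> 'h" where
  "op_matrix_of \<phi> i j h = \<phi> (axis (j = 1) h) $ (i = 1)"

lemma bounded_clinear_op_matrix_of:
  fixes \<phi> :: "'h::complex_hilbert ^ bool \<Rightarrow> 'h ^ bool"
  assumes "bounded_clinear \<phi>"
  shows "bounded_clinear (op_matrix_of \<phi> i j)"
proof -
  have "bounded_linear (axis k :: 'h \<Rightarrow> 'h ^ bool)" for k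
    by (rule bounded_linear_intro[where K = 1])
      (auto simp: axis_def vec_eq_iff norm_vec_def L2_set_def UNIV_bool)
  moreover have "bounded_linear \<phi>"
    using assms by (simp add: bounded_clinear_def)
  ultimately have "bounded_linear (\<lambda>h. \<phi> (axis (j = 1) h) $ (i = 1))"
    by (rule bounded_linear_compose[OF bounded_linear_vec_nth bounded_linear_compose, rotated])
  moreover have "axis k (c *\<^sub>C h) = c *\<^sub>C axis k h" for k :: bool and c and h :: 'h
    by (auto simp: axis_def vec_eq_iff scaleC_vec_def)
  ultimately show ?thesis
    using assms by (simp add: bounded_clinear_def op_matrix_of_def[abs_def] scaleC_vec_def)
qed

lemma op_matrix_apply_op_matrix_of:
  fixes \<phi> :: "'h::complex_hilbert ^ bool \<Rightarrow> 'h ^ bool"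
  assumes "bounded_clinear \<phi>"
  shows "op_matrix_apply 2 (op_matrix_of \<phi>) v i = \<phi> (vec_pair v) $ (i = 1)"
proof -
  have "vec_pair v = axis False (v 0) + axis True (v 1)"
    by (auto simp: vec_pair_def axis_def vec_eq_iff)
  then show ?thesis
    by (simp add: op_matrix_apply_def op_matrix_of_def numeral_2_eq_2 bounded_clinear_add[OF assms])
qed

lemma op_matrix_norm_op_matrix_of_le_1:
  fixes \<phi> :: "'h::complex_hilbert ^ bool \<Rightarrow> 'h ^ bool"
  assumes "bounded_clinear \<phi>" "\<And>v. norm (\<phi> v) \<le> norm v"
  shows "op_matrix_norm 2 (op_matrix_of \<phi>) \<le> 1"
  unfolding op_matrix_norm_def
proof (rule SUP_least)
  fix v :: "nat \<Rightarrow> 'h" assume v: "v \<in> {v. tuple_norm 2 v \<le> 1}"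
  have "vec_pair (op_matrix_apply 2 (op_matrix_of \<phi>) v) = \<phi> (vec_pair v)"
    by (simp add: vec_eq_iff vec_pair_def[of "op_matrix_apply _ _ _"]
        op_matrix_apply_op_matrix_of[OF assms(1)])
  then show "ereal (tuple_norm 2 (op_matrix_apply 2 (op_matrix_of \<phi>) v)) \<le> 1"
    using v assms(2)[of "vec_pair v"] by (simp add: tuple_norm_2)
qed

section \<open>Lower bounds for the completely bounded norm\<close>

lemma cb_norm_ge:
  assumes "n \<ge> 1" "op_matrix n X" "op_matrix_norm n X \<le> 1" "tuple_norm n v \<le> 1"
  shows "ereal (tuple_norm n (op_matrix_apply n (amplification T X) v)) \<le> cb_norm T"
proof -
  have "ereal (tuple_norm n (op_matrix_apply n (amplification T X) v))
      \<le> op_matrix_norm n (amplification T X)"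
    unfolding op_matrix_norm_def using assms by (intro SUP_upper) auto
  also have "\<dots> \<le> amplification_norm n T"
    unfolding amplification_norm_def using assms by (intro SUP_upper) auto
  also have "\<dots> \<le> cb_norm T"
    unfolding cb_norm_def using assms by (intro SUP_upper) auto
  finally show ?thesis .
qed

theorem theorem2:
  fixes a b :: "'h::complex_hilbert \<Rightarrow> 'h"
  assumes "complex_vector.dim (UNIV :: 'h set) = 2"
    and "bounded_clinear a" and "bounded_clinear b"
  shows "cb_norm (T_op a b) \<ge> ereal (hs_norm a * hs_norm b)"
proof -
  \<comment> \<open>\<open>E\<close> has to be the very basis selected in \<open>ctrace\<close>, so
    that \<open>hs_norm\<close> unfolds to sums over \<open>E\<close>.\<close>
  define E :: "'h set" where "E = (SOME B. orthonormal_basis B)"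
  have E: "orthonormal_basis E"
    unfolding E_def using orthonormal_basis_exists_dim_2[OF assms(1)] by (rule someI_ex)
  then have card: "card E = 2"
    using orthonormal_basis_card assms(1) by metis
  \<comment> \<open>An infinite set has \<open>card\<close> 0.\<close>
  then have "finite E"
    using card.infinite by force
  interpret finite_onb E
    by unfold_locales fact+
  obtain e :: "nat \<Rightarrow> 'h" where e: "bij_betw e {..<2} E"
    using ex_bij_betw_nat_finite[OF \<open>finite E\<close>] card by (auto simp: atLeast0LessThan)
  have sum_E: "(\<Sum>x\<in>E. f x) = (\<Sum>i<2. f (e i))" for f :: "'h \<Rightarrow> complex"
    using sum.reindex_bij_betw[OF e, of f] by simp
  \<comment> \<open>\<open>V f\<close> lists the columns of \<open>f\<close>, so
    \<open>cinner (V f) (V g)\<close> is trace(f* g).\<close>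
  define V where "V f = vec_pair (\<lambda>i. f (e i))" for f :: "'h \<Rightarrow> 'h"
  have V: "cinner (V f) (V g) = (\<Sum>x\<in>E. cinner (f x) (g x))" for f g
    by (simp add: V_def cinner_vec_pair sum_E)
  let ?A = "V a" and ?B = "V b" and ?A' = "V (cadjoint a)" and ?B' = "V (cadjoint b)"
  have hs: "hs_norm f = norm (V f)" if "bounded_clinear f" for f
    unfolding hs_norm_def ctrace_def E_def[symmetric]
    by (simp add: norm_eq_sqrt_cinner[of "V f"] V cinner_cadjoint[OF that])
  have adj: "cinner (V f) (V g) = cinner (V (cadjoint g)) (V (cadjoint f))"
    if "bounded_clinear f" "bounded_clinear g" for f g
    unfolding V by (rule sum_cinner_cadjoint[OF that])
  have nrm: "norm ?A' = norm ?A" "norm ?B' = norm ?B"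
    using adj assms by (simp_all add: norm_eq_sqrt_cinner)
  obtain \<phi> :: "'h ^ bool \<Rightarrow> 'h ^ bool"
    where \<phi>: "bounded_clinear \<phi>" "\<And>v. norm (\<phi> v) \<le> norm v"
    and \<phi>A: "\<phi> ?A = complex_of_real (norm ?A / norm ?B) *\<^sub>C ?B'"
    and \<phi>B: "\<phi> ?B = complex_of_real (norm ?B / norm ?A) *\<^sub>C ?A'"
    using contraction_extending[OF nrm adj[OF assms(2,3)]] by metis
  define X where "X = op_matrix_of \<phi>"
  define c where "c = complex_of_real (1 / sqrt 2)"
  define \<xi> where "\<xi> i = c *\<^sub>C e i" for i
  define \<eta> where "\<eta> = op_matrix_apply 2 (amplification (T_op a b) X) \<xi>"
  have cc: "c * c = 1 / 2" "cnj c = c"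
    by (simp_all add: c_def flip: of_real_mult)
  have e1: "cinner (e i) (e i) = 1" if "i < 2" for i
    using E e that unfolding orthonormal_basis_def by (metis bij_betwE lessThan_iff)
  have "cinner (vec_pair \<xi>) (vec_pair \<xi>) = 1"
    using e1[of 0] e1[of 1] cc by (simp add: cinner_vec_pair \<xi>_def cinner_simps numeral_2_eq_2 mult.commute)
  then have \<xi>: "norm (vec_pair \<xi>) = 1"
    by (simp add: norm_eq_sqrt_cinner)
  \<comment> \<open>Each summand of \<open>T_op a b\<close> has the form \<open>f\<close> after
    \<open>X i j\<close> after \<open>g\<close>. By linearity \<open>f\<close> and \<open>c\<close>
    leave the sum, and the matrix \<open>X\<close> acts on the columns of \<open>g\<close> as
    \<open>\<phi>\<close>.\<close>
  have pull: "(\<Sum>j<2. f (X i j (g (\<xi> j)))) = c *\<^sub>C f (\<phi> (V g) $ (i = 1))"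
    if f: "bounded_clinear f" and g: "bounded_clinear g" for f g i
  proof -
    have X: "X i j (g (\<xi> j)) = c *\<^sub>C X i j (g (e j))" for j
      using bounded_clinear_op_matrix_of[OF \<phi>(1)]
      by (simp add: \<xi>_def X_def bounded_clinear_scaleC[OF g] bounded_clinear_scaleC)
    have "(\<Sum>j<2. f (X i j (g (\<xi> j)))) = c *\<^sub>C f (\<Sum>j<2. X i j (g (e j)))"
      by (simp add: X bounded_clinear_scaleC[OF f] bounded_clinear_sum[OF f] numeral_2_eq_2
          scaleC_add_right bounded_clinear_add[OF f])
    then show ?thesis
      using op_matrix_apply_op_matrix_of[OF \<phi>(1), of "\<lambda>j. g (e j)" i]
      by (simp add: op_matrix_apply_def X_def V_def)
  qed
  have \<eta>: "\<eta> i = c *\<^sub>C a (\<phi> ?B $ (i = 1)) + c *\<^sub>C b (\<phi> ?A $ (i = 1))" for i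
    using pull[OF assms(2,3), of i] pull[OF assms(3,2), of i]
    by (simp add: \<eta>_def op_matrix_apply_def amplification_def T_op_def sum.distrib)
  \<comment> \<open>Moving \<open>f\<close> across as its adjoint turns \<open>\<xi>\<close> into
    the columns of that adjoint; the two factors \<open>c\<close> give the 1/2.\<close>
  have pair: "(\<Sum>i<2. cinner (\<xi> i) (c *\<^sub>C f (w $ (i = 1)))) = cinner (V (cadjoint f)) w / 2"
    if f: "bounded_clinear f" for f and w :: "'h ^ bool"
  proof -
    have *: "cinner (\<xi> i) (c *\<^sub>C f y) = cinner (cadjoint f (e i)) y / 2" for i y
      using cc by (simp add: \<xi>_def cinner_simps cinner_cadjoint'[OF f] mult.assoc[symmetric])
    show ?thesis
      unfolding * by (simp add: cinner_vec_def V_def vec_pair_def UNIV_bool numeral_2_eq_2 add_divide_distrib)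
  qed
  have "cinner (vec_pair \<xi>) (vec_pair \<eta>) = cinner ?A' (\<phi> ?B) / 2 + cinner ?B' (\<phi> ?A) / 2"
    unfolding cinner_vec_pair \<eta> cinner_add_right sum.distrib
      pair[OF assms(2)] pair[OF assms(3)] ..
  \<comment> \<open>Each of the two inner products equals \<open>norm ?A * norm ?B\<close>. If
    \<open>?A\<close> or \<open>?B\<close> is 0, the quotients of norms are 0 and so are both
    sides.\<close>
  also have "\<dots> = complex_of_real (norm ?A * norm ?B)"
    unfolding \<phi>A \<phi>B cinner_scaleC_right cinner_self nrm
    by (cases "norm ?A = 0"; cases "norm ?B = 0") (simp_all add: power2_eq_square)
  finally have "hs_norm a * hs_norm b = Re (cinner (vec_pair \<xi>) (vec_pair \<eta>))"
    using hs assms by simp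
  also have "\<dots> \<le> tuple_norm 2 \<eta>"
    unfolding tuple_norm_2 using \<xi> by (rule Re_cinner_le_norm)
  finally have "ereal (hs_norm a * hs_norm b) \<le> ereal (tuple_norm 2 \<eta>)"
    by simp
  \<comment> \<open>The contraction \<open>X\<close> and the unit vector \<open>\<xi>\<close> are
    admissible in the suprema defining the norm at \<open>n = 2\<close>.\<close>
  also have "\<dots> \<le> cb_norm (T_op a b)"
    unfolding \<eta>_def
  proof (rule cb_norm_ge)
    show "op_matrix 2 X"
      using bounded_clinear_op_matrix_of[OF \<phi>(1)] by (simp add: op_matrix_def X_def)
    show "op_matrix_norm 2 X \<le> 1"
      unfolding X_def using \<phi> by (rule op_matrix_norm_op_matrix_of_le_1)
    show "tuple_norm 2 \<xi> \<le> 1"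
      by (simp add: tuple_norm_2 \<xi>)
  qed simp
  finally show ?thesis .
qed

end
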